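(* The groups \[ \Gamma_{4} = \langle a,b,c,d \mid acac^{-1}, \, adad^{-1}, \, bcbd, \, bc^{-1}bd^{-1} \rangle \] and \[ \Gamma_{30} = \langle a,b,c,d \mid acad, \, ac^{-1}ad^{-1}, \, bcbd, \, bc^{-1}bd^{-1} \rangle \] are isomorphic.
   Context: The groups are given by finite presentations (generators, and relators set equal to $1$). *)

theory Defs
  imports "HOL-Algebra.Coset"
begin

(* The generating set of a free group or of a presentation is the whole type 'a. *)

datatype 'a letter = Pos 'a | Neg 'a

type_synonym 'a word = "'a letter list"

fun inv_letter :: "'a letter \<Rightarrow> 'a letter" where
  "inv_letter (Pos x) = Neg x"
| "inv_letter (Neg x) = Pos x"

inductive cancels :: "'a word \<Rightarrow> 'a word \<Rightarrow> bool" where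
  "cancels (u @ [l, inv_letter l] @ v) (u @ v)"

definition free_eq :: "('a word \<times> 'a word) set" where
  "free_eq = {(u, v). equivclp cancels u v}"

definition word_class :: "'a word \<Rightarrow> 'a word set" where
  "word_class w = free_eq `` {w}"

definition free_group :: "'a word set monoid" where
  "free_group =
     \<lparr>carrier = UNIV // free_eq,
      mult = (\<lambda>X Y. \<Union>u\<in>X. \<Union>v\<in>Y. word_class (u @ v)),
      one = word_class []\<rparr>"

definition normal_closure :: "('g, 'm) monoid_scheme \<Rightarrow> 'g set \<Rightarrow> 'g set" where
  "normal_closure G R = \<Inter>{N. N \<lhd> G \<and> R \<subseteq> N}"

definition presented_group :: "'a word set \<Rightarrow> 'a word set set monoid" where
  "presented_group R = free_group Mod normal_closure free_group (word_class ` R)"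

lemma inv_letter_inv_letter [simp]: "inv_letter (inv_letter l) = l"
  by (cases l) auto

lemma equiv_free_eq: "equiv UNIV free_eq"
proof (rule equivI)
  show "refl free_eq"
    by (simp add: free_eq_def refl_on_def)
  show "sym free_eq"
    unfolding free_eq_def sym_def by (blast intro: equivclp_sym)
  show "trans free_eq"
    unfolding free_eq_def trans_def by (blast intro: equivclp_trans)
qed simp

lemma word_class_eq_iff: "word_class u = word_class v \<longleftrightarrow> equivclp cancels u v"
  unfolding word_class_def eq_equiv_class_iff[OF equiv_free_eq UNIV_I UNIV_I]
  by (simp add: free_eq_def)

lemma carrier_free_group: "carrier free_group = range word_class"
  by (auto simp: free_group_def word_class_def quotient_def)

lemma one_free_group: "\<one>\<^bsub>free_group\<^esub> = word_class []"
  by (simp add: free_group_def)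

lemma cancels_context: "cancels u v \<Longrightarrow> cancels (x @ u @ y) (x @ v @ y)"
proof (erule cancels.cases)
  fix p l q assume "u = p @ [l, inv_letter l] @ q" "v = p @ q"
  then show "cancels (x @ u @ y) (x @ v @ y)"
    using cancels.intros[of "x @ p" l "q @ y"] by simp
qed

lemma free_eq_context:
  assumes "equivclp cancels u v"
  shows "equivclp cancels (x @ u @ y) (x @ v @ y)"
  using assms
proof (induction rule: equivclp_induct)
  case base
  show ?case by simp
next
  case (step v w)
  then have "cancels (x @ v @ y) (x @ w @ y) \<or> cancels (x @ w @ y) (x @ v @ y)"
    using cancels_context by blast
  with step.IH show ?case
    by (rule equivclp_into_equivclp)
qed

lemma free_eq_append:
  assumes "equivclp cancels u u'" "equivclp cancels v v'"
  shows "equivclp cancels (u @ v) (u' @ v')"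
proof -
  have "equivclp cancels (u @ v) (u' @ v)"
    using free_eq_context[OF assms(1), of "[]" v] by simp
  also have "equivclp cancels (u' @ v) (u' @ v')"
    using free_eq_context[OF assms(2), of u' "[]"] by simp
  finally show ?thesis .
qed

lemma mult_free_group:
  "word_class u \<otimes>\<^bsub>free_group\<^esub> word_class v = word_class (u @ v)"
proof -
  have eq: "word_class (u' @ v') = word_class (u @ v)"
    if "u' \<in> word_class u" "v' \<in> word_class v" for u' v'
  proof -
    have "equivclp cancels u u'" "equivclp cancels v v'"
      using that by (simp_all add: word_class_def free_eq_def)
    then have "equivclp cancels (u' @ v') (u @ v)"
      by (rule equivclp_sym[OF free_eq_append])
    then show ?thesis by (simp add: word_class_eq_iff)
  qed
  have mem: "w \<in> word_class w" for w :: "'a word"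
    by (simp add: word_class_def free_eq_def)
  have "(\<Union>u'\<in>word_class u. \<Union>v'\<in>word_class v. word_class (u' @ v'))
      = (\<Union>u'\<in>word_class u. \<Union>v'\<in>word_class v. word_class (u @ v))"
    by (intro SUP_cong refl eq)
  also have "\<dots> = word_class (u @ v)"
    using mem[of u] mem[of v] by blast
  finally show ?thesis by (simp add: free_group_def)
qed

lemma free_eq_inverse: "equivclp cancels (rev (map inv_letter w) @ w) []"
proof (induction w)
  case Nil
  show ?case by simp
next
  case (Cons l w)
  have "equivclp cancels (rev (map inv_letter w) @ [inv_letter l, inv_letter (inv_letter l)] @ w)
      (rev (map inv_letter w) @ w)"
    by (rule r_into_equivclp, rule cancels.intros)
  from equivclp_trans[OF this Cons.IH] show ?case by simp
qed

lemma group_free_group: "group free_group"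
proof (rule groupI)
  fix X assume "X \<in> carrier (free_group :: 'a word set monoid)"
  then obtain w where "X = word_class w" by (auto simp: carrier_free_group)
  then have "word_class (rev (map inv_letter w)) \<otimes>\<^bsub>free_group\<^esub> X = \<one>\<^bsub>free_group\<^esub>"
    by (simp add: mult_free_group one_free_group word_class_eq_iff free_eq_inverse)
  then show "\<exists>Y\<in>carrier free_group. Y \<otimes>\<^bsub>free_group\<^esub> X = \<one>\<^bsub>free_group\<^esub>"
    by (auto simp: carrier_free_group)
qed (auto simp: carrier_free_group one_free_group mult_free_group)

lemma (in group) normal_normal_closure:
  assumes "R \<subseteq> carrier G"
  shows "normal_closure G R \<lhd> G"
proof -
  let ?A = "{N. N \<lhd> G \<and> R \<subseteq> N}"
  have "carrier G \<lhd> G"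
    by (auto simp: normal_inv_iff subgroup_self)
  with assms have "?A \<noteq> {}" by blast
  then have "subgroup (\<Inter>?A) G"
    by (intro subgroups_Inter) (auto simp: normal_imp_subgroup)
  then show ?thesis
    unfolding normal_closure_def by (auto simp: normal_inv_iff)
qed

lemma group_presented_group: "group (presented_group R)"
  unfolding presented_group_def
  by (rule normal.factorgroup_is_group, rule group.normal_normal_closure[OF group_free_group])
     (auto simp: carrier_free_group)

datatype gen = gen_a | gen_b | gen_c | gen_d

definition Gamma4 :: "gen word set set monoid" where
  "Gamma4 = presented_group
     {[Pos gen_a, Pos gen_c, Pos gen_a, Neg gen_c],
      [Pos gen_a, Pos gen_d, Pos gen_a, Neg gen_d],
      [Pos gen_b, Pos gen_c, Pos gen_b, Pos gen_d],
      [Pos gen_b, Neg gen_c, Pos gen_b, Neg gen_d]}"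

definition Gamma30 :: "gen word set set monoid" where
  "Gamma30 = presented_group
     {[Pos gen_a, Pos gen_c, Pos gen_a, Pos gen_d],
      [Pos gen_a, Neg gen_c, Pos gen_a, Neg gen_d],
      [Pos gen_b, Pos gen_c, Pos gen_b, Pos gen_d],
      [Pos gen_b, Neg gen_c, Pos gen_b, Neg gen_d]}"

end

theory Submission
  imports Defs
begin

text \<open>
  In both groups the last relator reads \<open>d = b c\<inverse> b\<close>, and in \<open>\<Gamma>\<^sub>3\<^sub>0\<close> also \<open>d = a c\<inverse> a\<close>.
  Hence \<open>(b\<inverse> a) c\<inverse> (a b\<inverse>) = c\<inverse>\<close> in \<open>\<Gamma>\<^sub>3\<^sub>0\<close>, that is, \<open>b\<inverse> a\<close> is inverted by \<open>c\<inverse> b\<close>;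
  symmetrically it is inverted by \<open>c b\<close>. In \<open>\<Gamma>\<^sub>4\<close> the generator \<open>a\<close> is inverted by \<open>c\<close> and \<open>d\<close>.
  This suggests \<open>a \<mapsto> b\<inverse> a\<close>, \<open>b \<mapsto> b\<close>, \<open>c \<mapsto> c\<inverse> b\<close>, \<open>d \<mapsto> c b\<close> from \<open>\<Gamma>\<^sub>4\<close> to \<open>\<Gamma>\<^sub>3\<^sub>0\<close>, with
  inverse \<open>a \<mapsto> b a\<close>, \<open>b \<mapsto> b\<close>, \<open>c \<mapsto> b c\<inverse>\<close>, \<open>d \<mapsto> b c\<close>.
\<close>

section \<open>Evaluation of words in a group and the universal property of free groups\<close>

fun (in monoid) eval_letter :: "('x \<Rightarrow> 'a) \<Rightarrow> 'x letter \<Rightarrow> 'a" where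
  "eval_letter f (Pos x) = f x"
| "eval_letter f (Neg x) = inv (f x)"

fun (in monoid) eval_word :: "('x \<Rightarrow> 'a) \<Rightarrow> 'x word \<Rightarrow> 'a" where
  "eval_word f [] = \<one>"
| "eval_word f (l # w) = eval_letter f l \<otimes> eval_word f w"

context group
begin

lemma eval_letter_closed [simp]:
  "range f \<subseteq> carrier G \<Longrightarrow> eval_letter f l \<in> carrier G"
  by (cases l) auto

lemma eval_word_closed [simp]:
  "range f \<subseteq> carrier G \<Longrightarrow> eval_word f w \<in> carrier G"
  by (induction w) auto

lemma eval_word_append:
  "range f \<subseteq> carrier G \<Longrightarrow> eval_word f (u @ v) = eval_word f u \<otimes> eval_word f v"
  by (induction u) (simp_all add: m_assoc)

lemma eval_letter_inv_letter:
  "range f \<subseteq> carrier G \<Longrightarrow> eval_letter f (inv_letter l) = inv (eval_letter f l)"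
  by (cases l) (auto simp: image_subset_iff)

text \<open>The deleted pair contributes a factor times its own inverse.\<close>

lemma eval_word_cancels:
  assumes "range f \<subseteq> carrier G" "cancels u v"
  shows "eval_word f u = eval_word f v"
  using assms(2,1)
  by (cases rule: cancels.cases)
     (simp add: eval_word_append eval_letter_inv_letter flip: m_assoc)

lemma eval_word_free_eq:
  assumes "range f \<subseteq> carrier G" "equivclp cancels u v"
  shows "eval_word f u = eval_word f v"
  using assms(2)
  by (induction rule: equivclp_induct) (auto dest: eval_word_cancels[OF assms(1)])

lemma free_group_universal:
  assumes f: "range f \<subseteq> carrier G"
  obtains h where "h \<in> hom free_group G" "\<And>w. h (word_class w) = eval_word f w"
proof -
  \<comment> \<open>The chosen representative is immaterial: evaluation is constant on the classes
    of \<open>free_eq\<close>.\<close>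
  define h where "h X = eval_word f (SOME w. word_class w = X)" for X
  have h: "h (word_class w) = eval_word f w" for w
    unfolding h_def
    by (rule someI2[of _ w])
       (auto simp: word_class_eq_iff intro: eval_word_free_eq[OF f])
  moreover have "h \<in> hom free_group G"
    by (rule homI) (auto simp: carrier_free_group mult_free_group h eval_word_append f)
  ultimately show thesis using that by blast
qed

end

section \<open>Presented groups: images of words, and homomorphisms out of the quotient\<close>

definition presented_elem :: "'a word set \<Rightarrow> 'a word \<Rightarrow> 'a word set set" where
  "presented_elem R w =
     normal_closure free_group (word_class ` R) #>\<^bsub>free_group\<^esub> word_class w"

abbreviation generator :: "'a word set \<Rightarrow> 'a \<Rightarrow> 'a word set set" where
  "generator R x \<equiv> presented_elem R [Pos x]"

lemma normal_relators: "normal_closure free_group (word_class ` R) \<lhd> free_group"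
  by (rule group.normal_normal_closure[OF group_free_group]) (auto simp: carrier_free_group)

lemma relators_subset_normal_closure: "R \<subseteq> normal_closure G R"
  by (auto simp: normal_closure_def)

lemma carrier_presented_group: "carrier (presented_group R) = range (presented_elem R)"
  by (auto simp: presented_group_def carrier_FactGroup carrier_free_group presented_elem_def)

lemma presented_elem_closed [simp]: "presented_elem R w \<in> carrier (presented_group R)"
  by (simp add: carrier_presented_group)

lemma mult_presented_group:
  "presented_elem R u \<otimes>\<^bsub>presented_group R\<^esub> presented_elem R v = presented_elem R (u @ v)"
  unfolding presented_elem_def presented_group_def mult_FactGroup
  by (subst normal.rcos_sum[OF normal_relators]) (auto simp: carrier_free_group mult_free_group)

lemma presented_elem_Nil: "presented_elem R [] = \<one>\<^bsub>presented_group R\<^esub>"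
proof -
  interpret N: normal "normal_closure free_group (word_class ` R)" free_group
    by (rule normal_relators)
  show ?thesis
    unfolding presented_elem_def presented_group_def one_FactGroup
    by (intro N.coset_join2 N.subgroup_axioms)
       (simp_all flip: one_free_group)
qed

lemma presented_elem_relator:
  assumes "r \<in> R"
  shows "presented_elem R r = \<one>\<^bsub>presented_group R\<^esub>"
proof -
  interpret N: normal "normal_closure free_group (word_class ` R)" free_group
    by (rule normal_relators)
  show ?thesis
    unfolding presented_elem_def presented_group_def one_FactGroup
    using assms relators_subset_normal_closure[of "word_class ` R" free_group]
    by (intro N.coset_join2 N.subgroup_axioms) (auto simp: carrier_free_group)
qed

lemma presented_elem_Neg:
  "presented_elem R [Neg x] = inv\<^bsub>presented_group R\<^esub> generator R x"
proof -
  interpret P: group "presented_group R" by (rule group_presented_group)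
  have "word_class [Neg x, Pos x] = word_class []"
    using free_eq_inverse[of "[Pos x]"] by (simp add: word_class_eq_iff)
  then have "presented_elem R [Neg x] \<otimes>\<^bsub>presented_group R\<^esub> generator R x = \<one>\<^bsub>presented_group R\<^esub>"
    unfolding mult_presented_group presented_elem_Nil[symmetric]
    by (simp add: presented_elem_def)
  then show ?thesis by (rule P.inv_equality[symmetric]) simp_all
qed

text \<open>Every element is a product of generators and their inverses, so a homomorphism is
  determined by its values on generators. This later identifies composites with the
  identity.\<close>

lemma hom_presented_elem:
  assumes "group G" "h \<in> hom (presented_group R) G"
  shows "h (presented_elem R w) = monoid.eval_word G (\<lambda>x. h (generator R x)) w"
proof -
  interpret h: group_hom "presented_group R" G h
    using assms group_presented_group by (simp add: group_hom_def group_hom_axioms_def)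
  show ?thesis
  proof (induction w)
    case Nil
    show ?case by (simp add: presented_elem_Nil)
  next
    case (Cons l w)
    have "presented_elem R (l # w) = presented_elem R [l] \<otimes>\<^bsub>presented_group R\<^esub> presented_elem R w"
      by (simp add: mult_presented_group)
    then show ?case
      by (cases l) (simp_all add: Cons.IH presented_elem_Neg)
  qed
qed

lemma presented_elem_eq_eval_word:
  "presented_elem R w = monoid.eval_word (presented_group R) (generator R) w"
  \<comment> \<open>The identity homomorphism is determined by the generators in the same
    way.\<close>
  using hom_presented_elem[OF group_presented_group, where h = id and R = R and w = w] by (simp add: hom_def)

text \<open>Von Dyck's theorem. The kernel of evaluation on the free group is normal and contains
  the relators, hence contains their normal closure, so evaluation factors through the
  quotient.\<close>

lemma (in group) presented_group_universal:
  assumes f: "range f \<subseteq> carrier G" and relators: "\<And>r. r \<in> R \<Longrightarrow> eval_word f r = \<one>"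
  obtains h where "h \<in> hom (presented_group R) G" "\<And>w. h (presented_elem R w) = eval_word f w"
proof -
  obtain k where k: "k \<in> hom free_group G" "\<And>w. k (word_class w) = eval_word f w"
    using free_group_universal[OF f] by blast
  interpret k: group_hom free_group G k
    using k(1) group_free_group by (simp add: group_hom_def group_hom_axioms_def)
  have "word_class ` R \<subseteq> kernel free_group G k"
    using relators by (auto simp: kernel_def carrier_free_group k(2))
  then have "normal_closure free_group (word_class ` R) \<subseteq> kernel free_group G k"
    unfolding normal_closure_def using k.normal_kernel by blast
  then obtain h where
    "h \<in> hom (free_group Mod normal_closure free_group (word_class ` R)) G"
    "\<And>X. X \<in> carrier free_group \<Longrightarrow>
      h (normal_closure free_group (word_class ` R) #>\<^bsub>free_group\<^esub> X) = k X"
    using k.FactGroup_universal_kernel[OF normal_relators] by blast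
  then show thesis
    by (intro that) (auto simp: presented_group_def presented_elem_def carrier_free_group k(2))
qed

text \<open>Reduces an isomorphism to finding words \<open>\<phi>\<close> and \<open>\<psi>\<close>
  for the images of the generators. The relator conditions give homomorphisms both ways by von Dyck;
  the inverse conditions say that both composites fix the generators, so they are
  identities.\<close>

lemma presented_group_isoI:
  fixes R :: "'a word set" and S :: "'b word set"
    and \<phi> :: "'a \<Rightarrow> 'b word" and \<psi> :: "'b \<Rightarrow> 'a word"
  defines "f \<equiv> \<lambda>x. monoid.eval_word (presented_group S) (generator S) (\<phi> x)"
    and "g \<equiv> \<lambda>y. monoid.eval_word (presented_group R) (generator R) (\<psi> y)"
  assumes relators_R: "\<And>r. r \<in> R \<Longrightarrow> monoid.eval_word (presented_group S) f r = \<one>\<^bsub>presented_group S\<^esub>"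
    and relators_S: "\<And>s. s \<in> S \<Longrightarrow> monoid.eval_word (presented_group R) g s = \<one>\<^bsub>presented_group R\<^esub>"
    and inverse_R: "\<And>x. monoid.eval_word (presented_group R) g (\<phi> x) = generator R x"
    and inverse_S: "\<And>y. monoid.eval_word (presented_group S) f (\<psi> y) = generator S y"
  shows "presented_group R \<cong> presented_group S"
proof -
  interpret P: group "presented_group R" by (rule group_presented_group)
  interpret Q: group "presented_group S" by (rule group_presented_group)
  have f: "f = (\<lambda>x. presented_elem S (\<phi> x))" and g: "g = (\<lambda>y. presented_elem R (\<psi> y))"
    by (simp_all add: f_def g_def flip: presented_elem_eq_eval_word)
  have range_f: "range f \<subseteq> carrier (presented_group S)" by (auto simp: f)
  have range_g: "range g \<subseteq> carrier (presented_group R)" by (auto simp: g)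
  obtain h where h: "h \<in> hom (presented_group R) (presented_group S)"
      "\<And>w. h (presented_elem R w) = Q.eval_word f w"
    using Q.presented_group_universal[OF range_f relators_R] by blast
  obtain k where k: "k \<in> hom (presented_group S) (presented_group R)"
      "\<And>w. k (presented_elem S w) = P.eval_word g w"
    using P.presented_group_universal[OF range_g relators_S] by blast
  have "(k \<circ> h) (presented_elem R w) = presented_elem R w" for w
  proof -
    \<comment> \<open>\<open>h\<close> sends the generator \<open>x\<close> to the class of
      \<open>\<phi> x\<close>, which \<open>k\<close> evaluates at \<open>g\<close>.\<close>
    have "(\<lambda>x. (k \<circ> h) (generator R x)) = generator R"
      using inverse_R by (simp add: h(2) f k(2))
    then show ?thesis
      using hom_presented_elem[OF P.is_group Group.hom_compose[OF h(1) k(1)], of w]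
      by (simp only: presented_elem_eq_eval_word[symmetric])
  qed
  moreover have "(h \<circ> k) (presented_elem S w) = presented_elem S w" for w
  proof -
    have "(\<lambda>y. (h \<circ> k) (generator S y)) = generator S"
      using inverse_S by (simp add: k(2) g h(2))
    then show ?thesis
      using hom_presented_elem[OF Q.is_group Group.hom_compose[OF k(1) h(1)], of w]
      by (simp only: presented_elem_eq_eval_word[symmetric])
  qed
  ultimately have "group_isomorphisms (presented_group R) (presented_group S) h k"
    using h(1) k(1) by (auto simp: group_isomorphisms_def carrier_presented_group)
  then show ?thesis
    using P.iso_iff_group_isomorphisms by (auto simp: is_iso_def)
qed

text \<open>In right-nested products an inverse pair is usually followed by a further factor; these
  rules let the simplifier cancel it there.\<close>

lemma (in group) inv_mult_cancel_left [simp]: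
  "\<lbrakk>x \<in> carrier G; y \<in> carrier G\<rbrakk> \<Longrightarrow> x \<otimes> (inv x \<otimes> y) = y"
  "\<lbrakk>x \<in> carrier G; y \<in> carrier G\<rbrakk> \<Longrightarrow> inv x \<otimes> (x \<otimes> y) = y"
  by (simp_all flip: m_assoc)

section \<open>The two substitutions and the identities they require\<close>

definition relators4 :: "gen word set" where
  "relators4 =
     {[Pos gen_a, Pos gen_c, Pos gen_a, Neg gen_c],
      [Pos gen_a, Pos gen_d, Pos gen_a, Neg gen_d],
      [Pos gen_b, Pos gen_c, Pos gen_b, Pos gen_d],
      [Pos gen_b, Neg gen_c, Pos gen_b, Neg gen_d]}"

definition relators30 :: "gen word set" where
  "relators30 =
     {[Pos gen_a, Pos gen_c, Pos gen_a, Pos gen_d],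
      [Pos gen_a, Neg gen_c, Pos gen_a, Neg gen_d],
      [Pos gen_b, Pos gen_c, Pos gen_b, Pos gen_d],
      [Pos gen_b, Neg gen_c, Pos gen_b, Neg gen_d]}"

fun subst4 :: "gen \<Rightarrow> gen word" where
  "subst4 gen_a = [Neg gen_b, Pos gen_a]"
| "subst4 gen_b = [Pos gen_b]"
| "subst4 gen_c = [Neg gen_c, Pos gen_b]"
| "subst4 gen_d = [Pos gen_c, Pos gen_b]"

fun subst30 :: "gen \<Rightarrow> gen word" where
  "subst30 gen_a = [Pos gen_b, Pos gen_a]"
| "subst30 gen_b = [Pos gen_b]"
| "subst30 gen_c = [Pos gen_b, Neg gen_c]"
| "subst30 gen_d = [Pos gen_b, Pos gen_c]"

context group
begin

text \<open>Here \<open>a\<close>, \<open>b\<close>, \<open>c\<close>, \<open>d\<close> satisfy the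
  relations of \<open>Gamma30\<close>. The first three conclusions are the first three relators of
  \<open>Gamma4\<close> after \<open>subst4\<close> and free cancellation; the fourth relator
  cancels freely to the empty word. The last conclusion serves the inverse check.\<close>

lemma substituted_relators4:
  assumes [simp]: "a \<in> carrier G" "b \<in> carrier G" "c \<in> carrier G" "d \<in> carrier G"
    and rels: "a \<otimes> (c \<otimes> (a \<otimes> d)) = \<one>" "a \<otimes> (inv c \<otimes> (a \<otimes> inv d)) = \<one>"
      "b \<otimes> (c \<otimes> (b \<otimes> d)) = \<one>" "b \<otimes> (inv c \<otimes> (b \<otimes> inv d)) = \<one>"
  shows "inv b \<otimes> (a \<otimes> (inv c \<otimes> (a \<otimes> (inv b \<otimes> c)))) = \<one>"
    and "inv b \<otimes> (a \<otimes> (c \<otimes> (a \<otimes> (inv b \<otimes> inv c)))) = \<one>"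
    and "b \<otimes> (inv c \<otimes> (b \<otimes> (b \<otimes> (c \<otimes> b)))) = \<one>"
    and "b \<otimes> (inv c \<otimes> b) = d"
proof -
  have 1: "a \<otimes> (inv c \<otimes> a) = d" "b \<otimes> (inv c \<otimes> b) = d"
    using rels(2,4) inv_equality[of "a \<otimes> (inv c \<otimes> a)" "inv d"]
      inv_equality[of "b \<otimes> (inv c \<otimes> b)" "inv d"] by (simp_all add: m_assoc)
  then show "b \<otimes> (inv c \<otimes> b) = d" by blast
  have 2: "a \<otimes> (c \<otimes> a) = inv d" "b \<otimes> (c \<otimes> b) = inv d"
    using rels(1,3) inv_equality[of "a \<otimes> (c \<otimes> a)" d]
      inv_equality[of "b \<otimes> (c \<otimes> b)" d] by (simp_all add: m_assoc)
  have "inv b \<otimes> (a \<otimes> (inv c \<otimes> (a \<otimes> (inv b \<otimes> c)))) = inv b \<otimes> ((a \<otimes> (inv c \<otimes> a)) \<otimes> (inv b \<otimes> c))"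
    by (simp add: m_assoc)
  \<comment> \<open>The product sandwiched by \<open>a\<close> equals \<open>d\<close>, which is
    re-expanded as the same product sandwiched by \<open>b\<close>; everything then cancels.\<close>
  also have "\<dots> = \<one>" unfolding 1(1) by (simp add: m_assoc flip: 1(2))
  finally show "inv b \<otimes> (a \<otimes> (inv c \<otimes> (a \<otimes> (inv b \<otimes> c)))) = \<one>" .
  have "inv b \<otimes> (a \<otimes> (c \<otimes> (a \<otimes> (inv b \<otimes> inv c)))) = inv b \<otimes> ((a \<otimes> (c \<otimes> a)) \<otimes> (inv b \<otimes> inv c))"
    by (simp add: m_assoc)
  also have "\<dots> = \<one>" unfolding 2(1) by (simp add: m_assoc flip: 2(2))
  finally show "inv b \<otimes> (a \<otimes> (c \<otimes> (a \<otimes> (inv b \<otimes> inv c)))) = \<one>" .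
  have "b \<otimes> (inv c \<otimes> (b \<otimes> (b \<otimes> (c \<otimes> b)))) = (b \<otimes> (inv c \<otimes> b)) \<otimes> (b \<otimes> (c \<otimes> b))"
    by (simp add: m_assoc)
  also have "\<dots> = \<one>" unfolding 1 2 by simp
  finally show "b \<otimes> (inv c \<otimes> (b \<otimes> (b \<otimes> (c \<otimes> b)))) = \<one>" .
qed

text \<open>The reverse direction, under the relations of \<open>Gamma4\<close>: once
  \<open>b \<otimes> (inv c \<otimes> b)\<close> is replaced by \<open>d\<close>, it suffices that
  multiplying by \<open>a\<close> on both sides fixes \<open>c\<close> and \<open>d\<close>,
  together with the third relation. Again the fourth substituted relator is freely trivial.\<close>

lemma substituted_relators30:
  assumes [simp]: "a \<in> carrier G" "b \<in> carrier G" "c \<in> carrier G" "d \<in> carrier G"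
    and rels: "a \<otimes> (c \<otimes> (a \<otimes> inv c)) = \<one>" "a \<otimes> (d \<otimes> (a \<otimes> inv d)) = \<one>"
      "b \<otimes> (c \<otimes> (b \<otimes> d)) = \<one>" "b \<otimes> (inv c \<otimes> (b \<otimes> inv d)) = \<one>"
  shows "b \<otimes> (inv c \<otimes> b) = d"
    and "b \<otimes> (a \<otimes> (b \<otimes> (inv c \<otimes> (b \<otimes> (a \<otimes> (b \<otimes> c)))))) = \<one>"
    and "b \<otimes> (a \<otimes> (c \<otimes> (a \<otimes> (inv c \<otimes> inv b)))) = \<one>"
    and "b \<otimes> (b \<otimes> (inv c \<otimes> (b \<otimes> (b \<otimes> c)))) = \<one>"
proof -
  show 1: "b \<otimes> (inv c \<otimes> b) = d"
    using rels(4) inv_equality[of "b \<otimes> (inv c \<otimes> b)" "inv d"] by (simp add: m_assoc)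
  have 2: "a \<otimes> (d \<otimes> a) = d"
    using rels(2) inv_equality[of "a \<otimes> (d \<otimes> a)" "inv d"] by (simp add: m_assoc)
  have 3: "a \<otimes> (c \<otimes> a) = c"
    using rels(1) inv_equality[of "a \<otimes> (c \<otimes> a)" "inv c"] by (simp add: m_assoc)
  \<comment> \<open>A cyclic rotation of the third relator: if
    \<open>x \<otimes> y = \<one>\<close>, then \<open>y \<otimes> x = \<one>\<close>.\<close>
  have 4: "b \<otimes> (d \<otimes> (b \<otimes> c)) = \<one>"
    using inv_comm[of "b \<otimes> c" "b \<otimes> d"] rels(3) by (simp add: m_assoc)
  have "b \<otimes> (a \<otimes> (b \<otimes> (inv c \<otimes> (b \<otimes> (a \<otimes> (b \<otimes> c)))))) =
      b \<otimes> ((a \<otimes> ((b \<otimes> (inv c \<otimes> b)) \<otimes> a)) \<otimes> (b \<otimes> c))"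
    by (simp add: m_assoc)
  also have "\<dots> = \<one>" unfolding 1 2 by (rule 4)
  finally show "b \<otimes> (a \<otimes> (b \<otimes> (inv c \<otimes> (b \<otimes> (a \<otimes> (b \<otimes> c)))))) = \<one>" .
  have "b \<otimes> (a \<otimes> (c \<otimes> (a \<otimes> (inv c \<otimes> inv b)))) = b \<otimes> ((a \<otimes> (c \<otimes> a)) \<otimes> (inv c \<otimes> inv b))"
    by (simp add: m_assoc)
  also have "\<dots> = \<one>" unfolding 3 by simp
  finally show "b \<otimes> (a \<otimes> (c \<otimes> (a \<otimes> (inv c \<otimes> inv b)))) = \<one>" .
  have "b \<otimes> (b \<otimes> (inv c \<otimes> (b \<otimes> (b \<otimes> c)))) = b \<otimes> ((b \<otimes> (inv c \<otimes> b)) \<otimes> (b \<otimes> c))"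
    by (simp add: m_assoc)
  also have "\<dots> = \<one>" unfolding 1 by (rule 4)
  finally show "b \<otimes> (b \<otimes> (inv c \<otimes> (b \<otimes> (b \<otimes> c)))) = \<one>" .
qed

lemma eval_word_relators4:
  assumes "range f \<subseteq> carrier G" "\<forall>r\<in>relators30. eval_word f r = \<one>" "r \<in> relators4"
  shows "eval_word (\<lambda>x. eval_word f (subst4 x)) r = \<one>"
proof -
  have [simp]: "f x \<in> carrier G" for x using assms(1) by blast
  show ?thesis
    using substituted_relators4[of "f gen_a" "f gen_b" "f gen_c" "f gen_d"] assms(2,3)
    by (auto simp: relators4_def relators30_def m_assoc inv_mult_group)
qed

lemma eval_word_relators30:
  assumes "range f \<subseteq> carrier G" "\<forall>r\<in>relators4. eval_word f r = \<one>" "r \<in> relators30"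
  shows "eval_word (\<lambda>x. eval_word f (subst30 x)) r = \<one>"
proof -
  have [simp]: "f x \<in> carrier G" for x using assms(1) by blast
  show ?thesis
    using substituted_relators30[of "f gen_a" "f gen_b" "f gen_c" "f gen_d"] assms(2,3)
    by (auto simp: relators4_def relators30_def m_assoc inv_mult_group)
qed

text \<open>On \<open>a\<close>, \<open>b\<close> and \<open>c\<close> the composite substitution
  cancels freely to the generator; only \<open>d\<close> uses a relation, namely
  \<open>b \<otimes> (inv c \<otimes> b) = d\<close>. The other composite behaves alike.\<close>

lemma eval_word_subst4_subst30:
  assumes "range f \<subseteq> carrier G" "\<forall>r\<in>relators4. eval_word f r = \<one>"
  shows "eval_word (\<lambda>x. eval_word f (subst30 x)) (subst4 x) = f x"
proof -
  have [simp]: "f x \<in> carrier G" for x using assms(1) by blast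
  show ?thesis
    using substituted_relators30(1)[of "f gen_a" "f gen_b" "f gen_c" "f gen_d"] assms(2)
    by (cases x) (auto simp: relators4_def m_assoc inv_mult_group)
qed

lemma eval_word_subst30_subst4:
  assumes "range f \<subseteq> carrier G" "\<forall>r\<in>relators30. eval_word f r = \<one>"
  shows "eval_word (\<lambda>x. eval_word f (subst4 x)) (subst30 x) = f x"
proof -
  have [simp]: "f x \<in> carrier G" for x using assms(1) by blast
  show ?thesis
    using substituted_relators4(4)[of "f gen_a" "f gen_b" "f gen_c" "f gen_d"] assms(2)
    by (cases x) (auto simp: relators30_def m_assoc inv_mult_group)
qed

end

theorem proposition8:
  shows "Gamma4 \<cong> Gamma30"
proof -
  interpret P: group "presented_group relators4" by (rule group_presented_group)
  interpret Q: group "presented_group relators30" by (rule group_presented_group)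
  \<comment> \<open>The generators satisfy their own relators, so the lemmas on arbitrary
    \<open>f\<close> apply to \<open>f = generator R\<close>.\<close>
  have relators: "\<forall>r\<in>R. monoid.eval_word (presented_group R) (generator R) r = \<one>\<^bsub>presented_group R\<^esub>"
    for R :: "gen word set"
    using presented_elem_relator by (auto simp flip: presented_elem_eq_eval_word)
  have range: "range (generator R) \<subseteq> carrier (presented_group R)" for R :: "gen word set"
    by auto
  have "presented_group relators4 \<cong> presented_group relators30"
    \<comment> \<open>The relators of each group are checked in the other one, while each composite
      is checked in its own group.\<close>
    by (rule presented_group_isoI[where \<phi> = subst4 and \<psi> = subst30])
       (intro range relators P.eval_word_relators30 Q.eval_word_relators4
          P.eval_word_subst4_subst30 Q.eval_word_subst30_subst4, assumption?)+
  then show ?thesis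
    by (simp add: Gamma4_def Gamma30_def relators4_def relators30_def)
qed

end
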